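(* For any integers $d,k\ge 1$, the weak power of a clique $\mathbb{T}(d,k)$ satisfies $$\mathrm{tww}(\mathbb{T}(d,k))=\begin{cases}0 & \text{if } d=1 \text{ or } k\le 2,\\ 2(k-1)^{d-1} & \text{if } d\ge 2 \text{ and } k\ge 3.\end{cases}$$
   Context: All graphs are finite and simple (no loops or multiple edges). $K_k$ is the complete graph on $k$ vertices. Twin-width. A trigraph $G$ has a vertex set $V(G)$, a set $E(G)$ of black edges and a set $R(G)$ of red edges, with $E(G)\cap R(G)=\emptyset$; a graph is a trigraph with no red edges. $N_G(v)$ is the set of vertices joined to $v$ by a black or red edge. A $d$-trigraph is a trigraph in which every vertex is incident with at most $d$ red edges. A contraction merges two distinct (not necessarily adjacent) vertices $u,v$ into a new vertex $w$: every vertex other than $u,v$ in $N_G(u)\triangle N_G(v)$ is joined to $w$ by a red edge; every $x\in N_G(u)\cap N_G(v)$ is joined to $w$ by a black edge if $ux,vx\in E(G)$ and by a red edge otherwise; all edges not incident with $u$ or $v$ are unchanged, and $u,v$ and their incident edges are removed. A $d$-sequence of an $n$-vertex graph $G$ is a sequence of $d$-trigraphs $G_n=G,G_{n-1},\dots,G_1=K_1$ with each $G_{i-1}$ obtained from $G_i$ by one contraction. The twin-width $\mathrm{tww}(G)$ is the least $d$ such that $G$ admits a $d$-sequence. Tensor product. $G\times H$ has vertex set $V(G)\times V(H)$, and $(u,i)(v,j)$ is an edge iff $uv\in E(G)$ and $ij\in E(H)$. Weak powers of cliques. $\mathbb{T}(1,k)=K_k$ and $\mathbb{T}(d,k)=K_k\times\mathbb{T}(d-1,k)$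 for $d\ge 2$. *)

theory Defs
  imports Main
begin

text \<open>
  Edges are two-element sets of vertices. A graph is a trigraph without red edges, so there is
  one type for both.
\<close>

record 'a trigraph =
  verts :: "'a set"
  black :: "'a set set"
  red :: "'a set set"

definition is_trigraph :: "'a trigraph \<Rightarrow> bool" where
  "is_trigraph G \<longleftrightarrow>
     finite (verts G) \<and>
     black G \<union> red G \<subseteq> {e. e \<subseteq> verts G \<and> card e = 2} \<and>
     black G \<inter> red G = {}"

definition nbrs :: "'a trigraph \<Rightarrow> 'a \<Rightarrow> 'a set" where
  "nbrs G v = {x. {v, x} \<in> black G \<union> red G}"

definition is_d_trigraph :: "nat \<Rightarrow> 'a trigraph \<Rightarrow> bool" where
  "is_d_trigraph d G \<longleftrightarrow> is_trigraph G \<and> (\<forall>v\<in>verts G. card {e \<in> red G. v \<in> e} \<le> d)"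

definition contract :: "'a trigraph \<Rightarrow> 'a \<Rightarrow> 'a \<Rightarrow> 'a \<Rightarrow> 'a trigraph" where
  "contract G u v w =
     \<lparr>verts = insert w (verts G - {u, v}),
      black = {e \<in> black G. u \<notin> e \<and> v \<notin> e} \<union>
        {{x, w} | x. x \<in> verts G - {u, v} \<and> {u, x} \<in> black G \<and> {v, x} \<in> black G},
      red = {e \<in> red G. u \<notin> e \<and> v \<notin> e} \<union>
        {{x, w} | x. x \<in> verts G - {u, v} \<and>
           x \<in> (nbrs G u - nbrs G v) \<union> (nbrs G v - nbrs G u)} \<union>
        {{x, w} | x. x \<in> verts G - {u, v} \<and> x \<in> nbrs G u \<inter> nbrs G v \<and>
           \<not> ({u, x} \<in> black G \<and> {v, x} \<in> black G)}\<rparr>"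

text \<open>
  The merged vertex only has to differ from the remaining vertices. It may reuse the name of one
  of the two vertices that are removed, so that contractions also exist when the vertex type
  has no fresh element left.
\<close>

definition is_contraction :: "'a trigraph \<Rightarrow> 'a trigraph \<Rightarrow> bool" where
  "is_contraction G H \<longleftrightarrow>
     (\<exists>u\<in>verts G. \<exists>v\<in>verts G. \<exists>w. u \<noteq> v \<and> w \<notin> verts G - {u, v} \<and> H = contract G u v w)"

definition complete_graph :: "'a set \<Rightarrow> 'a trigraph" where
  "complete_graph V = \<lparr>verts = V, black = {e. e \<subseteq> V \<and> card e = 2}, red = {}\<rparr>"

definition is_d_sequence :: "nat \<Rightarrow> 'a trigraph \<Rightarrow> (nat \<Rightarrow> 'a trigraph) \<Rightarrow> bool" where
  "is_d_sequence d G S \<longleftrightarrow>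
     (let n = card (verts G) in
        S n = G \<and>
        (\<exists>v. S 1 = complete_graph {v}) \<and>
        (\<forall>i\<in>{1..n}. is_d_trigraph d (S i)) \<and>
        (\<forall>i\<in>{2..n}. is_contraction (S i) (S (i - 1))))"

text \<open>Only meaningful for nonempty graphs: the empty graph has no \<open>d\<close>-sequence.\<close>

definition tww :: "'a trigraph \<Rightarrow> nat" where
  "tww G = (LEAST d. \<exists>S. is_d_sequence d G S)"

text \<open>Tensor product of graphs; red edges of the arguments are not taken into account.\<close>

definition tensor :: "'a trigraph \<Rightarrow> 'b trigraph \<Rightarrow> ('a \<times> 'b) trigraph" where
  "tensor G H =
     \<lparr>verts = verts G \<times> verts H,
      black = {{(u, i), (v, j)} | u v i j. {u, v} \<in> black G \<and> {i, j} \<in> black H},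
      red = {}\<rparr>"

definition relabel :: "('a \<Rightarrow> 'b) \<Rightarrow> 'a trigraph \<Rightarrow> 'b trigraph" where
  "relabel f G =
     \<lparr>verts = f ` verts G, black = (\<lambda>e. f ` e) ` black G, red = (\<lambda>e. f ` e) ` red G\<rparr>"

text \<open>
  The vertex type of an iterated product would depend on the number of factors. Therefore each
  vertex \<open>(x, xs)\<close> of the product is renamed injectively to the list \<open>x # xs\<close>. The value at
  exponent \<open>0\<close> is a dummy.
\<close>

fun weak_power :: "nat \<Rightarrow> nat \<Rightarrow> nat list trigraph" where
  "weak_power 0 k = complete_graph {}"
| "weak_power (Suc 0) k = relabel (\<lambda>x. [x]) (complete_graph {..<k})"
| "weak_power (Suc (Suc d)) k =
     relabel (\<lambda>(x, xs). x # xs) (tensor (complete_graph {..<k}) (weak_power (Suc d) k))"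

end

theory Submission imports Defs
begin

text \<open>
  Vertices of \<open>T(d,k)\<close> are words of length \<open>d\<close>, adjacent iff they differ in every position. If
  distinct \<open>u\<close>, \<open>v\<close> differ at position \<open>c\<close>, the \<open>(k - 1)^(d - 1)\<close> neighbours of \<open>u\<close> that agree
  with \<open>v\<close> at \<open>c\<close> are not adjacent to \<open>v\<close> (if \<open>v\<close> is one of them, the word obtained from \<open>v\<close>
  by a third letter at \<open>c\<close> replaces it); by symmetry, already the first contraction creates a
  vertex of red degree at least \<open>2 (k - 1)^(d - 1)\<close>. Conversely, merge the letters
  \<open>1, 2, ...\<close> of the first position into \<open>0\<close> one after the other, each for all suffixes, and then
  do the same for the following positions. While the first position is being merged, a class has
  at most two red neighbours over each of the \<open>(k - 1)^(d - 1)\<close> suffixes adjacent to its own; at a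
  later position it has at most \<open>k\<close> over each of at most \<open>(k - 1)^(d - 2)\<close> suffixes, and
  \<open>k \<le> 2 (k - 1)\<close>. For \<open>k \<le> 2\<close> the graph is a matching plus isolated vertices.
\<close>

subsection \<open>Contraction sequences\<close>

text \<open>Sequences are built upwards from the single vertex, by rule induction; the indexed
  family of trigraphs appears only in \<open>contractible_is_d_sequence\<close>.\<close>

inductive contractible :: "nat \<Rightarrow> 'a trigraph \<Rightarrow> bool" for d where
  single: "contractible d (complete_graph {v})"
| step: "is_d_trigraph d G \<Longrightarrow> is_contraction G H \<Longrightarrow> contractible d H \<Longrightarrow> contractible d G"

lemma card_2_subset_singleton: "e \<subseteq> {v} \<Longrightarrow> card e \<noteq> 2"
  by (metis card.empty card_1_singleton_iff numeral_eq_one_iff One_nat_def semiring_norm(85)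
      subset_singletonD zero_neq_numeral)

lemma is_d_trigraph_complete_graph: "finite V \<Longrightarrow> is_d_trigraph d (complete_graph V)"
  by (auto simp: is_d_trigraph_def is_trigraph_def complete_graph_def)

lemma card_verts_contraction:
  assumes "is_contraction G H" "finite (verts G)"
  shows "card (verts G) = Suc (card (verts H))"
proof -
  obtain u v w where uv: "u \<in> verts G" "v \<in> verts G" "u \<noteq> v" "w \<notin> verts G - {u, v}"
    "H = contract G u v w"
    using assms(1) by (auto simp: is_contraction_def)
  have "card (verts G - {u, v}) = card (verts G) - 2"
    using uv assms(2) by (simp add: card_Diff_subset)
  moreover have "card (verts G) \<ge> 2"
    using uv assms(2) card_mono[of "verts G" "{u, v}"] by simp
  ultimately show ?thesis
    using uv assms(2) by (simp add: contract_def)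
qed

lemma contractible_is_d_sequence:
  assumes "contractible d G"
  shows "finite (verts G) \<and> card (verts G) \<ge> 1 \<and> (\<exists>S. is_d_sequence d G S)"
  using assms
proof induction
  case (single v)
  have "is_d_sequence d (complete_graph {v}) (\<lambda>_. complete_graph {v})"
    using is_d_trigraph_complete_graph[of "{v}" d]
    by (auto simp: is_d_sequence_def) (auto simp: complete_graph_def)
  then show ?case by (auto simp: complete_graph_def)
next
  case (step G H)
  then obtain S where S: "is_d_sequence d H S" by blast
  have fin: "finite (verts G)" using step by (auto simp: is_d_trigraph_def is_trigraph_def)
  have c: "card (verts G) = Suc (card (verts H))"
    using card_verts_contraction[OF step(2) fin] .
  \<comment> \<open>Indices are vertex counts, so \<open>G\<close> goes one place above
    \<open>H\<close>. As \<open>card (verts H)\<close> is at least 1, the last entry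
    \<open>S 1\<close> is not overwritten.\<close>
  have "is_d_sequence d G (S(card (verts G) := G))"
    using S step unfolding is_d_sequence_def Let_def c
    by (auto simp: le_Suc_eq)
  then show ?case using fin c by auto
qed

lemma tww_le: "contractible d G \<Longrightarrow> tww G \<le> d"
  using contractible_is_d_sequence[of d G] unfolding tww_def by (auto intro: Least_le)

text \<open>Any two vertices have the same neighbours outside the pair, so merging them creates no
  red edge and leaves a complete graph.\<close>

lemma contractible_complete_graph:
  "finite V \<Longrightarrow> V \<noteq> {} \<Longrightarrow> contractible 0 (complete_graph V)"
proof (induction "card V" arbitrary: V rule: less_induct)
  case less
  show ?case
  proof (cases "\<exists>v. V = {v}")
    case True
    then show ?thesis by (auto intro: single)
  next
    case False
    then obtain u v where uv: "u \<in> V" "v \<in> V" "u \<noteq> v" using less by blast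
    have nb: "nbrs (complete_graph V) a = V - {a}" if "a \<in> V" for a
      using that by (auto simp: nbrs_def complete_graph_def card_insert_if)
    have "contract (complete_graph V) u v u = complete_graph (V - {v})"
      unfolding contract_def nb[OF uv(1)] nb[OF uv(2)]
      using uv
      by (auto simp: complete_graph_def card_insert_if) (auto simp: card_2_iff)
    moreover have "contractible 0 (complete_graph (V - {v}))"
      using less uv by (intro less) (auto simp: card_gt_0_iff)
    ultimately have "is_contraction (complete_graph V) (complete_graph (V - {v}))"
      unfolding is_contraction_def using uv
      by (intro bexI[of _ u] bexI[of _ v] exI[of _ u]) (auto simp: complete_graph_def)
    then show ?thesis
      using step is_d_trigraph_complete_graph less(2) \<open>contractible 0 (complete_graph (V - {v}))\<close>
      by blast
  qed
qed

text \<open>Merging a pair without neighbours outside it creates no red edge: take the ends of an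
  edge, or any two vertices once no edge is left.\<close>

lemma contractible_matching:
  assumes "is_trigraph G" "red G = {}" "verts G \<noteq> {}"
    and "\<And>e e'. e \<in> black G \<Longrightarrow> e' \<in> black G \<Longrightarrow> e \<inter> e' \<noteq> {} \<Longrightarrow> e = e'"
  shows "contractible 0 G"
  using assms
proof (induction "card (verts G)" arbitrary: G rule: less_induct)
  case less
  have fin: "finite (verts G)" and sub: "\<And>e. e \<in> black G \<Longrightarrow> e \<subseteq> verts G \<and> card e = 2"
    using less(2) by (auto simp: is_trigraph_def)
  show ?case
  proof (cases "\<exists>v. verts G = {v}")
    case True
    then obtain v where v: "verts G = {v}" by blast
    have "black G = {}" using sub v card_2_subset_singleton[of _ v] by (metis all_not_in_conv)
    moreover have "black (complete_graph {v}) = {}"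
      using card_2_subset_singleton[of _ v] by (auto simp: complete_graph_def)
    ultimately have "G = complete_graph {v}" using v less(3)
      by (cases G) (simp add: complete_graph_def)
    then show ?thesis by (auto intro: single)
  next
    case False
    have "\<exists>u v. u \<in> verts G \<and> v \<in> verts G \<and> u \<noteq> v \<and>
      nbrs G u \<subseteq> {u, v} \<and> nbrs G v \<subseteq> {u, v}"
    proof (cases "black G = {}")
      case True
      then have "nbrs G u = {}" for u using less(3) by (auto simp: nbrs_def)
      then show ?thesis using False less(4) by blast
    next
      case False
      then obtain e where e: "e \<in> black G" by blast
      then obtain u v where uv: "e = {u, v}" "u \<noteq> v" using sub card_2_iff by metis
      have "nbrs G a \<subseteq> e" if "a \<in> e" for a
      proof
        fix x assume "x \<in> nbrs G a"
        then have "{a, x} \<in> black G" using less(3) by (simp add: nbrs_def)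
        then have "e = {a, x}" using less(5)[OF e] that by blast
        then show "x \<in> e" by simp
      qed
      then have "nbrs G u \<subseteq> {u, v}" "nbrs G v \<subseteq> {u, v}" using uv by auto
      moreover have "{u, v} \<subseteq> verts G" using sub[OF e] uv by simp
      ultimately show ?thesis using uv(2) by blast
    qed
    then obtain u v where uv: "u \<in> verts G" "v \<in> verts G" "u \<noteq> v"
      and n: "nbrs G u \<subseteq> {u, v}" "nbrs G v \<subseteq> {u, v}" by blast
    define H where "H = contract G u v u"
    have H: "red H = {}" "black H = {e \<in> black G. u \<notin> e \<and> v \<notin> e}" "verts H = verts G - {v}"
      using n uv less(3) unfolding H_def contract_def by (auto simp: nbrs_def)
    have "is_trigraph H" using H fin sub by (force simp: is_trigraph_def)
    then have "contractible 0 H"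
      using less uv H fin by (intro less(1)) (auto simp: card_gt_0_iff)
    moreover have "is_contraction G H" unfolding is_contraction_def H_def using uv by blast
    moreover have "is_d_trigraph 0 G" using less by (auto simp: is_d_trigraph_def)
    ultimately show ?thesis using step by blast
  qed
qed

subsection \<open>Quotient trigraphs\<close>

definition touch :: "'a trigraph \<Rightarrow> ('a \<Rightarrow> 'b) \<Rightarrow> 'b \<Rightarrow> 'b \<Rightarrow> bool" where
  "touch G f a b \<longleftrightarrow>
     (\<exists>x\<in>verts G. \<exists>y\<in>verts G. f x = a \<and> f y = b \<and> {x, y} \<in> black G)"

definition full :: "'a trigraph \<Rightarrow> ('a \<Rightarrow> 'b) \<Rightarrow> 'b \<Rightarrow> 'b \<Rightarrow> bool" where
  "full G f a b \<longleftrightarrow>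
     (\<forall>x\<in>verts G. \<forall>y\<in>verts G. f x = a \<longrightarrow> f y = b \<longrightarrow> {x, y} \<in> black G)"

definition mixed :: "'a trigraph \<Rightarrow> ('a \<Rightarrow> 'b) \<Rightarrow> 'b \<Rightarrow> 'b \<Rightarrow> bool" where
  "mixed G f a b \<longleftrightarrow> touch G f a b \<and> \<not> full G f a b"

text \<open>For a graph \<open>G\<close>, this is the trigraph reached when the merged sets are the
  fibres of \<open>f\<close>, in whatever order they were merged; contraction sequences thus become
  sequences of maps. An empty fibre is vacuously \<open>full\<close>, hence the restriction to
  values of \<open>f\<close>.\<close>

definition quot :: "'a trigraph \<Rightarrow> ('a \<Rightarrow> 'b) \<Rightarrow> 'b trigraph" where
  "quot G f =
     \<lparr>verts = f ` verts G,
      black = {{a, b} | a b. a \<in> f ` verts G \<and> b \<in> f ` verts G \<and> a \<noteq> b \<and> full G f a b},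
      red = {{a, b} | a b. a \<in> f ` verts G \<and> b \<in> f ` verts G \<and> a \<noteq> b \<and> mixed G f a b}\<rparr>"

lemma full_sym:
  assumes "full G f a b"
  shows "full G f b a"
  unfolding full_def
proof (intro ballI impI)
  fix x y assume "x \<in> verts G" "y \<in> verts G" "f x = b" "f y = a"
  then have "{y, x} \<in> black G" using assms by (simp add: full_def)
  then show "{x, y} \<in> black G" by (simp add: insert_commute)
qed

lemma full_commute: "full G f a b \<longleftrightarrow> full G f b a"
  by (rule iffI; erule full_sym)

lemma touch_sym:
  assumes "touch G f a b"
  shows "touch G f b a"
proof -
  obtain x y where *: "x \<in> verts G" "y \<in> verts G" "f x = a" "f y = b" "{x, y} \<in> black G"
    using assms unfolding touch_def by blast
  then have "{y, x} \<in> black G" by (simp add: insert_commute)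
  then show ?thesis using * unfolding touch_def by blast
qed

lemma mixed_commute: "mixed G f a b \<longleftrightarrow> mixed G f b a"
  unfolding mixed_def full_commute[of G f a b]
  by (auto intro: touch_sym)

lemma verts_quot: "verts (quot G f) = f ` verts G"
  by (simp add: quot_def)

lemma black_quot_iff:
  "{a, b} \<in> black (quot G f) \<longleftrightarrow>
     a \<in> f ` verts G \<and> b \<in> f ` verts G \<and> a \<noteq> b \<and> full G f a b"
  using full_commute[of G f a b] by (auto simp: quot_def doubleton_eq_iff)

lemma red_quot_iff:
  "{a, b} \<in> red (quot G f) \<longleftrightarrow>
     a \<in> f ` verts G \<and> b \<in> f ` verts G \<and> a \<noteq> b \<and> mixed G f a b"
  using mixed_commute[of G f a b] by (auto simp: quot_def doubleton_eq_iff)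

lemma quot_cong:
  assumes "\<And>x. x \<in> verts G \<Longrightarrow> f x = g x"
  shows "quot G f = quot G g"
proof -
  have "f ` verts G = g ` verts G" using assms by (rule image_cong[OF refl])
  moreover have "full G f = full G g" by (intro ext) (simp add: full_def assms)
  moreover have "touch G f = touch G g"
    by (intro ext) (simp add: touch_def assms cong: bex_cong_simp)
  ultimately show ?thesis by (simp add: quot_def mixed_def)
qed

lemma is_trigraph_quot: "finite (verts G) \<Longrightarrow> is_trigraph (quot G f)"
proof -
  assume "finite (verts G)"
  moreover have "black (quot G f) \<inter> red (quot G f) = {}"
  proof -
    have False if *: "e \<in> black (quot G f)" "e \<in> red (quot G f)" for e
    proof -
      obtain a b where e: "e = {a, b}" using *(1) by (auto simp: quot_def)
      then show False using * unfolding e black_quot_iff red_quot_iff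
        by (simp add: mixed_def)
    qed
    then show ?thesis by blast
  qed
  ultimately show ?thesis by (auto simp: is_trigraph_def quot_def)
qed

text \<open>Reduces equality of edge sets to pairs, the form in which \<open>black_quot_iff\<close>
  and \<open>red_quot_iff\<close> describe a quotient.\<close>

lemma trigraph_eqI:
  assumes "verts G = verts H"
    and "black G \<subseteq> {e. card e = 2}" "red G \<subseteq> {e. card e = 2}"
    and "black H \<subseteq> {e. card e = 2}" "red H \<subseteq> {e. card e = 2}"
    and "\<And>a b. a \<noteq> b \<Longrightarrow> {a, b} \<in> black G \<longleftrightarrow> {a, b} \<in> black H"
    and "\<And>a b. a \<noteq> b \<Longrightarrow> {a, b} \<in> red G \<longleftrightarrow> {a, b} \<in> red H"
  shows "G = (H :: 'a trigraph)"
proof -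
  have edges_eqI: "A = B"
    if "A \<subseteq> {e. card e = 2}" "B \<subseteq> {e. card e = 2}"
      and *: "\<And>a b. a \<noteq> b \<Longrightarrow> {a, b} \<in> A \<longleftrightarrow> {a, b} \<in> B"
    for A B :: "'a set set"
  proof (rule set_eqI)
    fix e
    show "e \<in> A \<longleftrightarrow> e \<in> B"
    proof (cases "card e = 2")
      case True
      then obtain a b where "e = {a, b}" "a \<noteq> b" by (auto simp: card_2_iff)
      then show ?thesis using * by simp
    next
      case False
      then show ?thesis using that(1,2) by blast
    qed
  qed
  have "black G = black H" using assms(2,4,6) by (rule edges_eqI)
  moreover have "red G = red H" using assms(3,5,7) by (rule edges_eqI)
  ultimately show ?thesis using assms(1) by (intro trigraph.equality) simp_all
qed

lemma quot_ident:
  assumes "is_trigraph G" "red G = {}"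
  shows "quot G (\<lambda>x. x) = G"
proof (rule trigraph_eqI)
  fix a b :: 'a
  show "{a, b} \<in> black (quot G (\<lambda>x. x)) \<longleftrightarrow> {a, b} \<in> black G" if "a \<noteq> b"
    using assms that unfolding black_quot_iff by (auto simp: full_def is_trigraph_def)
  show "{a, b} \<in> red (quot G (\<lambda>x. x)) \<longleftrightarrow> {a, b} \<in> red G" if "a \<noteq> b"
    using assms that unfolding red_quot_iff by (auto simp: mixed_def touch_def full_def)
qed (use assms is_trigraph_quot[of G "\<lambda>x. x"] in \<open>auto simp: is_trigraph_def verts_quot\<close>)

lemma nbrs_quot_iff:
  "b \<in> nbrs (quot G f) a \<longleftrightarrow>
     a \<in> f ` verts G \<and> b \<in> f ` verts G \<and> a \<noteq> b \<and> (full G f a b \<or> mixed G f a b)"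
  unfolding nbrs_def by (simp add: black_quot_iff red_quot_iff) blast

text \<open>A third fibre is full to the union of two fibres iff it is full to both, and touches it
  iff it touches one of them. This matches the colour rule of a contraction.\<close>

lemma contract_quot:
  fixes f g :: "'b \<Rightarrow> 'a"
  assumes ab: "a \<in> f ` verts G" "b \<in> f ` verts G" "a \<noteq> b"
    and g: "\<And>x. g x = (if f x = b then a else f x)"
  shows "contract (quot G f) a b a = quot G g"
    (is "?L = _")
proof (rule trigraph_eqI)
  have g_iff: "g x = a \<longleftrightarrow> f x = a \<or> f x = b" "c \<noteq> a \<Longrightarrow> c \<noteq> b \<Longrightarrow> g x = c \<longleftrightarrow> f x = c" for x c
    using ab(3) by (auto simp: g)
  have g_img: "g ` verts G = f ` verts G - {b}"
    using ab by (auto simp: image_iff g)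
  show "verts ?L = verts (quot G g)"
    using ab by (auto simp: contract_def verts_quot g_img)
  have ful: "full G g c e \<longleftrightarrow> full G f c e" if "c \<noteq> a" "e \<noteq> a" "c \<noteq> b" "e \<noteq> b" for c e
    using that by (simp add: full_def g_iff)
  have ful_a: "full G g a e \<longleftrightarrow> full G f a e \<and> full G f b e" if "e \<noteq> a" "e \<noteq> b" for e
    using that by (simp add: full_def g_iff) blast
  have touch: "touch G g c e \<longleftrightarrow> touch G f c e" if "c \<noteq> a" "e \<noteq> a" "c \<noteq> b" "e \<noteq> b" for c e
    using that by (simp add: touch_def g_iff)
  have touch_a: "touch G g a e \<longleftrightarrow> touch G f a e \<or> touch G f b e" if "e \<noteq> a" "e \<noteq> b" for e
    using that by (simp add: touch_def g_iff) blast
  \<comment> \<open>This makes adjacency in the quotient, in either colour, the same as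
    \<open>touch\<close>.\<close>
  have full_touch: "full G f c e \<Longrightarrow> touch G f c e" if "c \<in> f ` verts G" "e \<in> f ` verts G" for c e
    using that unfolding full_def touch_def by blast
  have black_a: "{a, e} \<in> black ?L \<longleftrightarrow> {a, e} \<in> black (quot G g)" if "a \<noteq> e" for e
    unfolding black_quot_iff g_img using that ab ful_a[of e]
    by (auto simp: contract_def black_quot_iff verts_quot doubleton_eq_iff)
  have red_a: "{a, e} \<in> red ?L \<longleftrightarrow> {a, e} \<in> red (quot G g)" if "a \<noteq> e" for e
    unfolding red_quot_iff g_img
    using that ab ful_a[of e] touch_a[of e] full_touch[of a e] full_touch[of b e]
    by (auto simp: contract_def black_quot_iff red_quot_iff verts_quot doubleton_eq_iff
        nbrs_quot_iff mixed_def)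
  have black_c: "{c, e} \<in> black ?L \<longleftrightarrow> {c, e} \<in> black (quot G g)"
    if "a \<noteq> e" "a \<noteq> c" "c \<noteq> e" for c e
    unfolding black_quot_iff g_img using that ab ful[of c e]
    by (auto simp: contract_def black_quot_iff verts_quot doubleton_eq_iff)
  have red_c: "{c, e} \<in> red ?L \<longleftrightarrow> {c, e} \<in> red (quot G g)"
    if "a \<noteq> e" "a \<noteq> c" "c \<noteq> e" for c e
    unfolding red_quot_iff g_img using that ab ful[of c e] touch[of c e]
    by (auto simp: contract_def red_quot_iff verts_quot doubleton_eq_iff mixed_def)
  fix c e :: 'a assume "c \<noteq> e"
  then consider "c = a" "a \<noteq> e" | "e = a" "a \<noteq> c" | "a \<noteq> e" "a \<noteq> c" "c \<noteq> e" by blast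
  then show "{c, e} \<in> black ?L \<longleftrightarrow> {c, e} \<in> black (quot G g)"
    "{c, e} \<in> red ?L \<longleftrightarrow> {c, e} \<in> red (quot G g)"
    by (cases; simp only: black_a black_c red_a red_c insert_commute[of c a])+
qed (auto simp: contract_def quot_def)

text \<open>An edge through \<open>v\<close> is determined by its other end, so the red degree can
  be counted by neighbours.\<close>

lemma card_edges_eq_card_nbrs:
  assumes "R \<subseteq> {e. card e = 2}"
  shows "card {e \<in> R. v \<in> e} = card {x. {v, x} \<in> R}"
proof -
  have "{e \<in> R. v \<in> e} = (\<lambda>x. {v, x}) ` {x. {v, x} \<in> R}"
  proof (intro equalityI subsetI)
    fix e assume e: "e \<in> {e \<in> R. v \<in> e}"
    then have "card e = 2" "v \<in> e" using assms by auto
    then obtain x where "e = {v, x}" by (auto simp: card_2_iff)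
    then show "e \<in> (\<lambda>x. {v, x}) ` {x. {v, x} \<in> R}" using e by auto
  qed auto
  moreover have "inj_on (\<lambda>x. {v, x}) {x. {v, x} \<in> R}"
    by (auto simp: inj_on_def doubleton_eq_iff)
  ultimately show ?thesis by (simp add: card_image)
qed

text \<open>A small covering set \<open>S\<close> suffices, so the exact red neighbourhood of a
  class never has to be determined.\<close>

lemma is_d_trigraph_quot:
  assumes "finite (verts G)"
    and "\<And>a. a \<in> f ` verts G \<Longrightarrow>
      \<exists>S. finite S \<and> card S \<le> d \<and> (\<forall>b. b \<noteq> a \<longrightarrow> mixed G f a b \<longrightarrow> b \<in> S)"
  shows "is_d_trigraph d (quot G f)"
  unfolding is_d_trigraph_def
proof (intro conjI ballI)
  show tri: "is_trigraph (quot G f)" using assms(1) by (rule is_trigraph_quot)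
  fix a assume "a \<in> verts (quot G f)"
  then obtain S where S: "finite S" "card S \<le> d" "\<And>b. b \<noteq> a \<Longrightarrow> mixed G f a b \<Longrightarrow> b \<in> S"
    using assms(2) by (metis verts_quot)
  have "card {e \<in> red (quot G f). a \<in> e} = card {b. {a, b} \<in> red (quot G f)}"
    using tri by (intro card_edges_eq_card_nbrs) (auto simp: is_trigraph_def)
  also have "\<dots> \<le> card S"
    using S(1,3) by (intro card_mono) (auto simp: red_quot_iff)
  finally show "card {e \<in> red (quot G f). a \<in> e} \<le> d" using S(2) by simp
qed

lemma contractible_quot_step:
  assumes "is_d_trigraph d (quot G f)" "a \<in> f ` verts G" "b \<in> f ` verts G" "a \<noteq> b"
    and "\<And>x. x \<in> verts G \<Longrightarrow> g x = (if f x = b then a else f x)"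
    and "contractible d (quot G g)"
  shows "contractible d (quot G f)"
proof (rule step)
  have "contract (quot G f) a b a = quot G (\<lambda>x. if f x = b then a else f x)"
    using assms(2-4) by (rule contract_quot) simp
  also have "\<dots> = quot G g" using assms(5) by (intro quot_cong) simp
  finally show "is_contraction (quot G f) (quot G g)"
    unfolding is_contraction_def verts_quot using assms(2-4)
    by (intro bexI[of _ a] bexI[of _ b] exI[of _ a]) auto
qed (use assms in simp_all)

subsection \<open>Weak powers as graphs on words\<close>

definition words :: "nat \<Rightarrow> nat \<Rightarrow> nat list set" where
  "words k d = {xs. set xs \<subseteq> {..<k} \<and> length xs = d}"

abbreviation differ :: "nat list \<Rightarrow> nat list \<Rightarrow> bool" where
  "differ \<equiv> list_all2 (\<noteq>)"

lemma finite_words: "finite (words k d)"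
  by (simp add: words_def finite_lists_length_eq)

lemma card_words: "card (words k d) = k ^ d"
  by (simp add: words_def card_lists_length_eq)

lemma words_Suc: "words k (Suc d) = (\<lambda>(x, xs). x # xs) ` ({..<k} \<times> words k d)"
  by (auto simp: words_def length_Suc_conv image_iff)

lemma Cons_in_words: "x # xs \<in> words k (Suc d) \<longleftrightarrow> x < k \<and> xs \<in> words k d"
  by (auto simp: words_def)

lemma differ_sym: "differ xs ys \<Longrightarrow> differ ys xs"
  by (auto simp: list_all2_conv_all_nth)

lemma differ_irrefl: "xs \<in> words k d \<Longrightarrow> d \<ge> 1 \<Longrightarrow> \<not> differ xs xs"
  by (cases xs) (auto simp: words_def)

text \<open>Induction over the factors: each product puts one letter in front, and the prolonged
  words are adjacent iff these letters differ and the tails are adjacent.\<close>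

lemma weak_power_eq:
  assumes "d \<ge> 1"
  shows "weak_power d k =
    \<lparr>verts = words k d, black = {{xs, ys} | xs ys. xs \<in> words k d \<and> ys \<in> words k d \<and> differ xs ys},
     red = {}\<rparr>"
  using assms
proof (induction d rule: nat_induct_at_least)
  case base
  have w: "words k 1 = (\<lambda>x. [x]) ` {..<k}"
    by (auto simp: words_def length_Suc_conv)
  have "black (weak_power 1 k) = {{xs, ys} | xs ys. xs \<in> words k 1 \<and> ys \<in> words k 1 \<and> differ xs ys}"
    (is "?B = ?W")
  proof (intro equalityI subsetI)
    fix E assume "E \<in> ?B"
    then obtain e where e: "E = (\<lambda>x. [x]) ` e" "e \<subseteq> {..<k}" "card e = 2"
      by (auto simp: relabel_def complete_graph_def)
    then obtain x y where "e = {x, y}" "x \<noteq> y" by (auto simp: card_2_iff)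
    with e have "E = {[x], [y]}" "[x] \<in> words k 1" "[y] \<in> words k 1" "differ [x] [y]"
      by (simp_all add: words_def)
    then show "E \<in> ?W" by blast
  next
    fix E assume "E \<in> ?W"
    then obtain x y where "E = {[x], [y]}" "x < k" "y < k" "x \<noteq> y"
      unfolding w by auto
    then have "E = (\<lambda>x. [x]) ` {x, y}" "{x, y} \<subseteq> {..<k}" "card {x, y} = 2" by auto
    then have "E \<in> (\<lambda>e. (\<lambda>x. [x]) ` e) ` {e. e \<subseteq> {..<k} \<and> card e = 2}"
      by (intro image_eqI[of _ _ "{x, y}"]) simp_all
    then show "E \<in> ?B" by (simp add: relabel_def complete_graph_def)
  qed
  moreover have "verts (weak_power 1 k) = words k 1" "red (weak_power 1 k) = {}"
    unfolding w by (auto simp: relabel_def complete_graph_def)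
  ultimately show ?case by (intro trigraph.equality) simp_all
next
  case (Suc d)
  have wp: "weak_power (Suc d) k =
      relabel (\<lambda>(x, xs). x # xs) (tensor (complete_graph {..<k}) (weak_power d k))"
    using Suc(1) by (cases d) simp_all
  have b: "{xs, ys} \<in> black (weak_power d k) \<longleftrightarrow> xs \<in> words k d \<and> ys \<in> words k d \<and> differ xs ys"
    for xs ys
    unfolding Suc(2) using differ_sym by (auto simp: doubleton_eq_iff)
  have c: "{i, j} \<in> black (complete_graph {..<k}) \<longleftrightarrow> i < k \<and> j < k \<and> i \<noteq> j" for i j
    by (auto simp: complete_graph_def card_insert_if)
  have "black (weak_power (Suc d) k) =
      {{xs, ys} | xs ys. xs \<in> words k (Suc d) \<and> ys \<in> words k (Suc d) \<and> differ xs ys}"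
    (is "?B = ?W")
  proof (intro equalityI subsetI)
    fix E assume "E \<in> ?B"
    then obtain u v i j where "E = (\<lambda>(x, xs). x # xs) ` {(u, i), (v, j)}"
      "{u, v} \<in> black (complete_graph {..<k})" "{i, j} \<in> black (weak_power d k)"
      unfolding wp by (auto simp: relabel_def tensor_def)
    then have "E = {u # i, v # j}" "u # i \<in> words k (Suc d)" "v # j \<in> words k (Suc d)"
      "differ (u # i) (v # j)"
      by (simp_all add: b c Cons_in_words)
    then show "E \<in> ?W" by blast
  next
    fix E assume "E \<in> ?W"
    then obtain xs ys where E: "E = {xs, ys}" "xs \<in> words k (Suc d)" "ys \<in> words k (Suc d)"
      "differ xs ys" by blast
    then obtain u i v j where xy: "xs = u # i" "ys = v # j"
      by (auto simp: words_Suc)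
    have *: "{u, v} \<in> black (complete_graph {..<k})" "{i, j} \<in> black (weak_power d k)"
      using E by (simp_all add: xy b c Cons_in_words)
    then have "{(u, i), (v, j)} \<in> black (tensor (complete_graph {..<k}) (weak_power d k))"
      by (auto simp: tensor_def)
    moreover have "E = (\<lambda>(x, xs). x # xs) ` {(u, i), (v, j)}" by (simp add: E xy)
    ultimately have "E \<in> (\<lambda>e. (\<lambda>(x, xs). x # xs) ` e) `
        black (tensor (complete_graph {..<k}) (weak_power d k))"
      by (rule rev_image_eqI)
    then show "E \<in> ?B" unfolding wp by (simp add: relabel_def)
  qed
  moreover have "verts (weak_power (Suc d) k) = words k (Suc d)" "red (weak_power (Suc d) k) = {}"
    unfolding wp words_Suc by (simp_all add: relabel_def tensor_def complete_graph_def Suc(2))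
  ultimately show ?case by (intro trigraph.equality) simp_all
qed

lemma verts_weak_power: "d \<ge> 1 \<Longrightarrow> verts (weak_power d k) = words k d"
  and red_weak_power: "d \<ge> 1 \<Longrightarrow> red (weak_power d k) = {}"
  by (simp_all add: weak_power_eq)

lemma black_weak_power_iff:
  "d \<ge> 1 \<Longrightarrow> {xs, ys} \<in> black (weak_power d k) \<longleftrightarrow>
     xs \<in> words k d \<and> ys \<in> words k d \<and> differ xs ys"
  using differ_sym by (auto simp: weak_power_eq doubleton_eq_iff)

lemma is_trigraph_weak_power:
  assumes "d \<ge> 1"
  shows "is_trigraph (weak_power d k)"
proof -
  have "xs \<noteq> ys" if "xs \<in> words k d" "differ xs ys" for xs ys
    using that assms differ_irrefl by blast
  then show ?thesis using assms
    by (auto simp: is_trigraph_def weak_power_eq finite_words card_insert_if)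
qed

text \<open>The length is read off from the word, so that the notion also applies to prefixes and
  suffixes of vertices.\<close>

definition nbr_words :: "nat \<Rightarrow> nat list \<Rightarrow> nat list set" where
  "nbr_words k xs = {ys \<in> words k (length xs). differ xs ys}"

lemma nbrs_weak_power:
  "d \<ge> 1 \<Longrightarrow> xs \<in> words k d \<Longrightarrow> nbrs (weak_power d k) xs = nbr_words k xs"
  by (auto simp: nbrs_def black_weak_power_iff red_weak_power nbr_words_def words_def)

lemma not_nbr_words: "i < length xs \<Longrightarrow> xs ! i = ys ! i \<Longrightarrow> ys \<notin> nbr_words k xs"
  by (auto simp: nbr_words_def dest: list_all2_nthD)

lemma finite_nbr_words: "finite (nbr_words k xs)"
  unfolding nbr_words_def using finite_words by simp

lemma card_nbr_words: "xs \<in> words k d \<Longrightarrow> card (nbr_words k xs) = (k - 1) ^ d"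
proof (induction xs arbitrary: d)
  case Nil
  then have "nbr_words k [] = {[]}" by (auto simp: nbr_words_def words_def)
  then show ?case using Nil by (simp add: words_def)
next
  case (Cons x xs)
  then obtain e where d: "d = Suc e" by (auto simp: words_def)
  have x: "x < k" "xs \<in> words k e" using Cons(2) by (simp_all add: d Cons_in_words)
  have "nbr_words k (x # xs) = (\<lambda>(y, ys). y # ys) ` (({..<k} - {x}) \<times> nbr_words k xs)"
    by (auto simp: nbr_words_def Cons_in_words list_all2_Cons1 image_iff)
  moreover have "inj_on (\<lambda>(y, ys). y # ys) (({..<k} - {x}) \<times> nbr_words k xs)"
    by (auto simp: inj_on_def)
  ultimately have "card (nbr_words k (x # xs)) = card ({..<k} - {x}) * card (nbr_words k xs)"
    by (simp add: card_image card_cartesian_product)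
  then show ?case using Cons.IH[OF x(2)] x(1) d by simp
qed

subsection \<open>The first contraction\<close>

text \<open>\<open>v\<close> is excluded because it is itself merged and yields no red edge. This
  costs a word only if \<open>u\<close> and \<open>v\<close> are adjacent, and then a substitute is
  found.\<close>

lemma card_private_nbrs:
  assumes u: "u \<in> words k d" and v: "v \<in> words k d" and uv: "u \<noteq> v" and "d \<ge> 2" "k \<ge> 3"
  shows "(k - 1) ^ (d - 1) \<le> card (nbr_words k u - nbr_words k v - {v})"
proof -
  obtain c where c: "c < d" "u ! c \<noteq> v ! c"
    using u v uv by (auto simp: words_def list_eq_iff_nth_eq)
  \<comment> \<open>Agreement with \<open>v\<close> at \<open>c\<close> rules out adjacency to
    \<open>v\<close>; the map \<open>h\<close> shows that the other \<open>d - 1\<close> positions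
    stay free, with \<open>k - 1\<close> choices each.\<close>
  define P where "P = {x \<in> nbr_words k u. x ! c = v ! c}"
  define h where "h = (\<lambda>(xs, ys). xs @ v ! c # ys :: nat list)"
  let ?u1 = "take c u" and ?u2 = "drop (Suc c) u"
  have u_split: "u = ?u1 @ u ! c # ?u2" using c u by (simp add: words_def id_take_nth_drop)
  have vc: "v ! c < k" using v c by (auto simp: words_def) (meson lessThan_iff nth_mem subsetD)
  have u12: "?u1 \<in> words k c" "?u2 \<in> words k (d - Suc c)"
    using u c by (auto simp: words_def dest: in_set_takeD in_set_dropD)
  have "h ` (nbr_words k ?u1 \<times> nbr_words k ?u2) \<subseteq> P"
  proof clarify
    fix xs ys assume "xs \<in> nbr_words k ?u1" "ys \<in> nbr_words k ?u2"
    then have *: "set xs \<subseteq> {..<k}" "set ys \<subseteq> {..<k}" "differ ?u1 xs" "differ ?u2 ys"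
      "length xs = c" "length ys = d - Suc c"
      using u c by (auto simp: nbr_words_def words_def)
    have "differ u (h (xs, ys))"
      unfolding h_def prod.case by (subst u_split) (use * c in \<open>auto intro!: list_all2_appendI\<close>)
    then show "h (xs, ys) \<in> P"
      using * vc c u by (auto simp: P_def h_def nbr_words_def words_def nth_append)
  qed
  moreover have "inj_on h (nbr_words k ?u1 \<times> nbr_words k ?u2)"
    by (auto simp: inj_on_def h_def nbr_words_def words_def)
  moreover have fin: "finite P" unfolding P_def using finite_nbr_words by simp
  ultimately have "card (nbr_words k ?u1) * card (nbr_words k ?u2) \<le> card P"
    by (metis card_cartesian_product card_image card_mono)
  then have "(k - 1) ^ c * (k - 1) ^ (d - Suc c) \<le> card P"
    by (simp add: card_nbr_words[OF u12(1)] card_nbr_words[OF u12(2)])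
  then have card_P: "(k - 1) ^ (d - 1) \<le> card P"
    using c by (simp flip: power_add)
  have len: "length u = d" "length v = d" using u v by (simp_all add: words_def)
  have sub: "P \<subseteq> nbr_words k u - nbr_words k v"
    using c(1) len not_nbr_words[of c v] by (auto simp: P_def)
  have fin_D: "finite (nbr_words k u - nbr_words k v - {v})" using finite_nbr_words by simp
  show ?thesis
  proof (cases "v \<in> P")
    case False
    then show ?thesis using sub card_P card_mono[OF fin_D, of P] by fastforce
  next
    case True
    \<comment> \<open>A second position exists as \<open>d \<ge> 2\<close>. Changing
      \<open>v\<close> at \<open>c\<close> alone leaves agreement at \<open>c'\<close>, so the new
      word is not adjacent to \<open>v\<close>.\<close>
    define c' where "c' = (if c = 0 then 1 else 0 :: nat)"
    have c': "c' \<noteq> c" "c' < d" using \<open>d \<ge> 2\<close> by (auto simp: c'_def)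
    have "\<exists>z<k. z \<noteq> u ! c \<and> z \<noteq> v ! c"
    proof -
      have "\<not> {..<k} \<subseteq> {u ! c, v ! c}"
        using card_mono[of "{u ! c, v ! c}" "{..<k}"] \<open>k \<ge> 3\<close>
        by (auto simp: card_insert_if split: if_splits)
      then show ?thesis by blast
    qed
    then obtain z where z: "z < k" "z \<noteq> u ! c" "z \<noteq> v ! c" by blast
    \<comment> \<open>\<open>z\<close> differs from \<open>u ! c\<close>, so \<open>x\<close> is
      still adjacent to \<open>u\<close>; it differs from \<open>v ! c\<close>, so \<open>x\<close>
      lies outside \<open>P\<close>.\<close>
    define x where "x = v[c := z]"
    have "differ u v" using True by (simp add: P_def nbr_words_def)
    then have "x \<in> nbr_words k u"
      using z v u c set_update_subset_insert[of v c z]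
      by (auto simp: nbr_words_def words_def x_def list_all2_conv_all_nth nth_list_update)
    moreover have "x ! c' = v ! c'" using c' by (simp add: x_def)
    then have "x \<notin> nbr_words k v"
      using c'(2) len not_nbr_words[of c' v x] by simp
    moreover have "x ! c = z" using c(1) len by (simp add: x_def)
    then have "x \<notin> P" "x \<noteq> v" using z by (auto simp: P_def)
    ultimately have "insert x (P - {v}) \<subseteq> nbr_words k u - nbr_words k v - {v}"
      using sub by blast
    moreover have "card (insert x (P - {v})) = card P"
      using fin \<open>x \<notin> P\<close> card_Suc_Diff1[OF fin True] by (simp del: card_Diff_insert)
    ultimately show ?thesis using card_P card_mono[OF fin_D] by (metis le_trans)
  qed
qed

lemma d_sequence_weak_power_ge:
  assumes S: "is_d_sequence D (weak_power d k) S" and d: "d \<ge> 2" and k: "k \<ge> 3"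
  shows "2 * (k - 1) ^ (d - 1) \<le> D"
proof -
  let ?G = "weak_power d k"
  define n where "n = card (verts ?G)"
  have d1: "d \<ge> 1" using d by simp
  have "k ^ 1 \<le> k ^ d" using d k by (intro power_increasing) auto
  \<comment> \<open>With two vertices a first contraction takes place, and \<open>n - 1\<close> is a
    valid index.\<close>
  then have n: "n \<ge> 2" using k d1 by (simp add: n_def verts_weak_power card_words)
  have "S n = ?G" "\<And>i. i \<in> {1..n} \<Longrightarrow> is_d_trigraph D (S i)"
    "\<And>i. i \<in> {2..n} \<Longrightarrow> is_contraction (S i) (S (i - 1))"
    using S by (simp_all add: is_d_sequence_def Let_def n_def)
  from this(1) this(2)[of "n - 1"] this(3)[of n]
  have H: "is_contraction ?G (S (n - 1))" "is_d_trigraph D (S (n - 1))"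
    using n by simp_all
  obtain u v w where uv: "u \<in> words k d" "v \<in> words k d" "u \<noteq> v" "w \<notin> words k d - {u, v}"
    and S_eq: "S (n - 1) = contract ?G u v w"
    using H(1) by (auto simp: is_contraction_def verts_weak_power[OF d1])
  \<comment> \<open>Each set avoids the neighbours of the other vertex, so the two are disjoint; all
    their members become red neighbours of \<open>w\<close>.\<close>
  let ?A = "nbr_words k u - nbr_words k v - {v}" and ?B = "nbr_words k v - nbr_words k u - {u}"
  have irr: "x \<notin> nbr_words k x" if "x \<in> words k d" for x
    using differ_irrefl[OF that d1] by (simp add: nbr_words_def)
  have "{w, x} \<in> red (S (n - 1))" if "x \<in> ?A \<union> ?B" for x
  proof -
    have "x \<in> words k d - {u, v}"
      using that uv irr by (auto simp: nbr_words_def words_def)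
    then show ?thesis
      using that uv unfolding S_eq contract_def
      by (auto simp: nbrs_weak_power[OF d1] verts_weak_power[OF d1] insert_commute)
  qed
  then have sub: "?A \<union> ?B \<subseteq> {x. {w, x} \<in> red (S (n - 1))}" by blast
  have tri: "is_trigraph (S (n - 1))" using H(2) by (simp add: is_d_trigraph_def)
  have "{x. {w, x} \<in> red (S (n - 1))} \<subseteq> verts (S (n - 1))"
    using tri by (auto simp: is_trigraph_def)
  then have fin: "finite {x. {w, x} \<in> red (S (n - 1))}"
    using tri by (auto simp: is_trigraph_def intro: finite_subset)
  have "2 * (k - 1) ^ (d - 1) \<le> card ?A + card ?B"
    using card_private_nbrs[of u k d v] card_private_nbrs[of v k d u] uv d k by simp
  also have "\<dots> = card (?A \<union> ?B)"
    using finite_nbr_words by (intro card_Un_disjoint[symmetric]) auto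
  also have "\<dots> \<le> card {x. {w, x} \<in> red (S (n - 1))}" using sub fin by (rule card_mono[rotated])
  also have "\<dots> = card {e \<in> red (S (n - 1)). w \<in> e}"
    using tri by (intro card_edges_eq_card_nbrs[symmetric]) (auto simp: is_trigraph_def)
  also have "\<dots> \<le> D"
  proof -
    have "w \<in> verts (S (n - 1))" unfolding S_eq by (simp add: contract_def)
    then show ?thesis using H(2) by (simp add: is_d_trigraph_def)
  qed
  finally show ?thesis .
qed

subsection \<open>A contraction sequence\<close>

text \<open>The class of a word, named by a representative, while position \<open>p\<close> is being merged: the
  first \<open>p\<close> letters no longer matter, and \<open>Z\<close> collects the suffixes from position \<open>p\<close> on whose
  first letter has already been merged into \<open>0\<close>.\<close>

definition clear :: "nat \<Rightarrow> nat list set \<Rightarrow> nat list \<Rightarrow> nat list" where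
  "clear p Z x = replicate p 0 @ (if drop p x \<in> Z then 0 else x ! p) # drop (Suc p) x"

text \<open>Suffixes starting with \<open>0\<close> are the targets of merging; each of the others
  accounts for one contraction in the phase of its position.\<close>

definition suffixes :: "nat \<Rightarrow> nat \<Rightarrow> nat list set" where
  "suffixes k m = {w \<in> words k m. hd w \<noteq> 0}"

text \<open>Suffixes are merged in the order of their first letters.\<close>

definition admissible :: "nat \<Rightarrow> nat \<Rightarrow> nat list set \<Rightarrow> bool" where
  "admissible k m Z \<longleftrightarrow> Z \<subseteq> suffixes k m \<and>
     (\<forall>w\<in>Z. \<forall>w'\<in>suffixes k m. hd w' < hd w \<longrightarrow> w' \<in> Z)"

lemma words_drop: "x \<in> words k d \<Longrightarrow> drop p x \<in> words k (d - p)"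
  by (auto simp: words_def dest: in_set_dropD)

lemma differ_drop: "differ x y \<Longrightarrow> differ (drop p x) (drop p y)"
  by (rule list_all2_dropI)

text \<open>In the first phase the suffix of a word is the word itself. Two classes with distinct
  first letters \<open>i, j > 0\<close> are singletons and hence not joined by a red edge. The class of
  \<open>0 # y\<close> is therefore joined in red, over each neighbour \<open>z\<close> of \<open>y\<close>, at most to \<open>0 # z\<close> and
  to \<open>i # z\<close>, where \<open>i\<close> is the letter that is currently being merged.\<close>

lemma is_d_trigraph_clear_0:
  assumes d: "d \<ge> 1" and Z: "admissible k d Z"
  shows "is_d_trigraph (2 * (k - 1) ^ (d - 1)) (quot (weak_power d k) (clear 0 Z))"
proof (rule is_d_trigraph_quot)
  let ?G = "weak_power d k"
  have V: "verts ?G = words k d" using d by (rule verts_weak_power)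
  show "finite (verts ?G)" by (simp add: V finite_words)
  fix a assume "a \<in> clear 0 Z ` verts ?G"
  then obtain w where w: "w \<in> words k d" "a = clear 0 Z w" by (auto simp: V)
  obtain e where e: "d = Suc e" using d by (cases d) auto
  obtain j y where wjy: "w = j # y" "y \<in> words k e" using w by (auto simp: e words_Suc)
  have clear_Cons: "clear 0 Z (i # z) = (if i # z \<in> Z then 0 else i) # z" for i z
    by (simp add: clear_def)
  have Z_pos: "i \<noteq> 0" if "i # z \<in> Z" for i z
    using Z that by (auto simp: admissible_def suffixes_def)
  have card_img: "card ((\<lambda>z. i # z) ` nbr_words k y) = (k - 1) ^ e" for i
    using card_nbr_words[OF wjy(2)] by (simp add: card_image)
  \<comment> \<open>If no letter qualifies, \<open>act\<close> is arbitrary, and the size bound for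
    \<open>?S\<close> holds all the same.\<close>
  define act where "act = (SOME i. i # y \<in> Z \<and> (\<exists>z. i # z \<in> suffixes k d - Z))"
  \<comment> \<open>Two letters \<open>i < j\<close> cannot both qualify: a merged
    \<open>j # y\<close> forces every suffix with first letter \<open>i\<close> into
    \<open>Z\<close>.\<close>
  have act: "i = act" if i: "i # y \<in> Z" "i # z \<in> suffixes k d - Z" for i z
  proof -
    have "\<exists>z. act # z \<in> suffixes k d - Z" "act # y \<in> Z"
      using someI[of "\<lambda>i. i # y \<in> Z \<and> (\<exists>z. i # z \<in> suffixes k d - Z)" i] i
      unfolding act_def by blast+
    then show ?thesis
      using i Z unfolding admissible_def by (metis DiffD1 DiffD2 linorder_neqE_nat list.sel(1))
  qed
  let ?S = "(\<lambda>z. 0 # z) ` nbr_words k y \<union> (\<lambda>z. act # z) ` nbr_words k y"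
  show "\<exists>S. finite S \<and> card S \<le> 2 * (k - 1) ^ (d - 1) \<and>
      (\<forall>b. b \<noteq> a \<longrightarrow> mixed ?G (clear 0 Z) a b \<longrightarrow> b \<in> S)"
  proof (intro exI[of _ ?S] conjI allI impI)
    show "finite ?S" using finite_nbr_words by simp
    have "card ?S \<le> (k - 1) ^ e + (k - 1) ^ e"
      using card_Un_le[of "(\<lambda>z. 0 # z) ` nbr_words k y" "(\<lambda>z. act # z) ` nbr_words k y"]
      by (simp add: card_img)
    then show "card ?S \<le> 2 * (k - 1) ^ (d - 1)" by (simp add: e)
    fix b assume mix: "mixed ?G (clear 0 Z) a b"
    obtain u v where uv: "u \<in> words k d" "v \<in> words k d" "clear 0 Z u = a" "clear 0 Z v = b"
        "differ u v"
      using mix by (auto simp: mixed_def touch_def V black_weak_power_iff[OF d])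
    obtain u' v' where uv': "u' \<in> words k d" "v' \<in> words k d" "clear 0 Z u' = a"
        "clear 0 Z v' = b" "\<not> differ u' v'"
      using mix by (auto simp: mixed_def full_def V black_weak_power_iff[OF d])
    obtain i z where v: "v = i # z" using uv(2) by (auto simp: e words_Suc)
    obtain i' z' where v': "v' = i' # z'" using uv'(2) by (auto simp: e words_Suc)
    obtain l x where u: "u = l # x" using uv(1) by (auto simp: e words_Suc)
    obtain l' x' where u': "u' = l' # x'" using uv'(1) by (auto simp: e words_Suc)
    have tails: "x = y" "x' = y" "z' = z"
      using uv(3) uv'(3) uv(4) uv'(4) w(2) unfolding u u' v v' wjy clear_Cons by auto
    have zN: "z \<in> nbr_words k y"
      using uv wjy unfolding u v tails e by (auto simp: nbr_words_def words_def)
    \<comment> \<open>By \<open>differ u v\<close> the tails \<open>y\<close> and \<open>z\<close>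
      differ everywhere, so the nonadjacent words \<open>u'\<close> and \<open>v'\<close> must share
      their first letter.\<close>
    have l'i': "l' = i'"
      using uv uv' unfolding u v u' v' tails by simp
    show "b \<in> ?S"
    proof (cases "hd b = 0")
      case True
      then show ?thesis using uv(4) zN unfolding v clear_Cons by auto
    next
      case False
      then have i: "i = i'" "i # z \<notin> Z" "i \<noteq> 0" "b = i # z"
        using uv(4) uv'(4) unfolding v v' tails clear_Cons by (auto split: if_splits)
      have "l \<noteq> i" using uv(5) by (simp add: u v)
      \<comment> \<open>\<open>l # y\<close> and \<open>i # y\<close> lie in the same class but
        start with different letters, so that class starts with \<open>0\<close>; as
        \<open>i > 0\<close>, the suffix \<open>i # y\<close> has been merged.\<close>
      moreover have "(if l # y \<in> Z then 0 else l) = (if i # y \<in> Z then 0 else i)"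
        using trans[OF uv(3) uv'(3)[symmetric]] unfolding u u' tails clear_Cons l'i' i(1) by simp
      ultimately have "i # y \<in> Z" using i(3) Z_pos by (auto split: if_splits)
      moreover have "i # z \<in> suffixes k d - Z"
        using i uv(2) unfolding v by (simp add: suffixes_def)
      ultimately show ?thesis using act i(4) zN by blast
    qed
  qed
qed

text \<open>Here it suffices to count all touching classes: the current letter is arbitrary, the
  tail after it must differ everywhere.\<close>

lemma is_d_trigraph_clear_Suc:
  assumes d: "Suc p < d" and k: "k \<ge> 2"
  shows "is_d_trigraph (2 * (k - 1) ^ (d - 1)) (quot (weak_power d k) (clear (Suc p) Z))"
proof (rule is_d_trigraph_quot)
  let ?G = "weak_power d k" and ?p = "Suc p"
  have d1: "d \<ge> 1" using d by simp
  have V: "verts ?G = words k d" using d1 by (rule verts_weak_power)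
  show "finite (verts ?G)" by (simp add: V finite_words)
  fix a assume "a \<in> clear ?p Z ` verts ?G"
  then obtain w where w: "w \<in> words k d" "a = clear ?p Z w" by (auto simp: V)
  let ?y = "drop (Suc ?p) w"
  let ?S = "(\<lambda>(i, z). replicate ?p 0 @ i # z) ` ({..<k} \<times> nbr_words k ?y)"
  show "\<exists>S. finite S \<and> card S \<le> 2 * (k - 1) ^ (d - 1) \<and>
      (\<forall>b. b \<noteq> a \<longrightarrow> mixed ?G (clear ?p Z) a b \<longrightarrow> b \<in> S)"
  proof (intro exI[of _ ?S] conjI allI impI)
    show "finite ?S" using finite_nbr_words by simp
    have "card ?S \<le> card ({..<k} \<times> nbr_words k ?y)"
      using finite_nbr_words by (intro card_image_le) simp
    also have "\<dots> = k * (k - 1) ^ (d - Suc ?p)"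
      using card_nbr_words[OF words_drop[OF w(1), of "Suc ?p"]] by (simp add: card_cartesian_product)
    \<comment> \<open>The tail has at most \<open>d - 2\<close> letters because a position precedes
      the current one. At position 0 the same count gives \<open>k * (k - 1) ^ (d - 1)\<close>, too
      much for \<open>k \<ge> 3\<close>.\<close>
    also have "\<dots> \<le> (2 * (k - 1)) * (k - 1) ^ (d - 2)"
      using k d by (intro mult_le_mono power_increasing) auto
    also have "\<dots> = 2 * (k - 1) ^ (d - 1)"
    proof -
      have "d - 1 = Suc (d - 2)" using d by simp
      then show ?thesis by simp
    qed
    finally show "card ?S \<le> 2 * (k - 1) ^ (d - 1)" .
    fix b assume "mixed ?G (clear ?p Z) a b"
    then obtain u v where uv: "u \<in> words k d" "v \<in> words k d" "clear ?p Z u = a"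
        "clear ?p Z v = b" "differ u v"
      by (auto simp: mixed_def touch_def V black_weak_power_iff[OF d1])
    have y: "?y = drop (Suc ?p) u" using uv(3) w(2) by (simp add: clear_def)
    have "drop (Suc ?p) v \<in> nbr_words k ?y"
      using words_drop[OF uv(1), of "Suc ?p"] words_drop[OF uv(2), of "Suc ?p"]
        differ_drop[OF uv(5), of "Suc ?p"]
      unfolding y nbr_words_def by (simp add: words_def)
    moreover have "v ! ?p < k"
      using uv(2) d by (auto simp: words_def) (meson lessThan_iff nth_mem subsetD)
    moreover have "0 < k" using k by simp
    ultimately show "b \<in> ?S"
      unfolding uv(4)[symmetric] clear_def by (auto simp del: replicate.simps drop_Suc)
  qed
qed

lemma is_d_trigraph_clear:
  assumes "p < d" "k \<ge> 2" "admissible k (d - p) Z"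
  shows "is_d_trigraph (2 * (k - 1) ^ (d - 1)) (quot (weak_power d k) (clear p Z))"
proof (cases p)
  case 0
  then show ?thesis using assms is_d_trigraph_clear_0[of d k Z] by simp
next
  case (Suc q)
  then show ?thesis using assms is_d_trigraph_clear_Suc by simp
qed

section \<open>Merging one position, then all positions in turn\<close>

lemma finite_suffixes: "finite (suffixes k m)"
  by (simp add: suffixes_def finite_words)

lemma drop_eq_nth_Cons: "x \<in> words k d \<Longrightarrow> p < d \<Longrightarrow> drop p x = x ! p # drop (Suc p) x"
  by (simp add: words_def Cons_nth_drop_Suc)

text \<open>Induction on the number of suffixes still to be merged at position \<open>p\<close>, one
  contraction for each.\<close>

lemma contractible_clear:
  assumes p: "p < d" and k: "k \<ge> 2" and "admissible k (d - p) Z"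
    and "contractible (2 * (k - 1) ^ (d - 1)) (quot (weak_power d k) (clear p (suffixes k (d - p))))"
  shows "contractible (2 * (k - 1) ^ (d - 1)) (quot (weak_power d k) (clear p Z))"
  using assms(3)
proof (induction "card (suffixes k (d - p) - Z)" arbitrary: Z rule: less_induct)
  case less
  let ?F = "suffixes k (d - p)"
  show ?case
  proof (cases "?F - Z = {}")
    case True
    then have "Z = ?F" using less(2) by (auto simp: admissible_def)
    then show ?thesis using assms(4) by simp
  next
    case False
    \<comment> \<open>Choosing a least first letter among the unmerged suffixes keeps
      \<open>insert w Z\<close> admissible.\<close>
    define w where "w = arg_min_on hd (?F - Z)"
    have fin: "finite (?F - Z)" using finite_suffixes by simp
    have w: "w \<in> ?F - Z" and w_min: "\<And>w'. w' \<in> ?F - Z \<Longrightarrow> hd w \<le> hd w'"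
      using arg_min_if_finite[OF fin False, of hd] unfolding w_def by (auto simp: not_less)
    obtain i y where iy: "w = i # y" "i < k" "i \<noteq> 0" "y \<in> words k (d - Suc p)"
    proof -
      have "w \<in> words k (Suc (d - Suc p))" using w p by (simp add: suffixes_def Suc_diff_Suc)
      then show thesis using that w by (auto simp: words_Suc suffixes_def)
    qed
    have adm: "admissible k (d - p) (insert w Z)"
      using less(2) w w_min unfolding admissible_def
      by (metis Diff_iff insert_iff insert_subset leD)
    have "card (?F - insert w Z) < card (?F - Z)"
      using w fin by (intro psubset_card_mono) auto
    then have IH: "contractible (2 * (k - 1) ^ (d - 1)) (quot (weak_power d k) (clear p (insert w Z)))"
      using less(1) adm by blast
    have V: "verts (weak_power d k) = words k d" using p by (simp add: verts_weak_power)
    have pre: "replicate p 0 @ j # y \<in> words k d" if "j < k" for j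
      using that iy(4) p k by (auto simp: words_def)
    \<comment> \<open>Hence the class of \<open>0 # y\<close> keeps its name throughout the phase
      and can serve as the target.\<close>
    have nZ: "0 # y \<notin> Z" using less(2) by (auto simp: admissible_def suffixes_def)
    have clear_pre: "clear p Z (replicate p 0 @ j # y) = replicate p 0 @ j # y" if "j # y \<notin> Z" for j
      using that by (simp add: clear_def nth_append)
    show ?thesis
    proof (rule contractible_quot_step[OF _ _ _ _ _ IH])
      show "is_d_trigraph (2 * (k - 1) ^ (d - 1)) (quot (weak_power d k) (clear p Z))"
        using p k less(2) by (rule is_d_trigraph_clear)
      show "replicate p 0 @ 0 # y \<in> clear p Z ` verts (weak_power d k)"
        unfolding V using pre[of 0] clear_pre[OF nZ] k by (intro rev_image_eqI) auto
      show "replicate p 0 @ i # y \<in> clear p Z ` verts (weak_power d k)"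
        unfolding V using pre[of i] clear_pre[of i] iy w by (intro rev_image_eqI) auto
      show "replicate p 0 @ 0 # y \<noteq> replicate p 0 @ i # y" using iy(3) by simp
      fix x assume "x \<in> verts (weak_power d k)"
      then have "drop p x = x ! p # drop (Suc p) x" using p by (simp add: V drop_eq_nth_Cons)
      then show "clear p (insert w Z) x =
          (if clear p Z x = replicate p 0 @ i # y then replicate p 0 @ 0 # y else clear p Z x)"
        using w iy by (auto simp: clear_def)
    qed
  qed
qed

lemma admissible_empty: "admissible k m {}"
  by (simp add: admissible_def)

text \<open>At the end of a phase every class name has \<open>0\<close> at position
  \<open>p\<close>, which thereby joins the cleared prefix.\<close>

lemma clear_suffixes:
  assumes "x \<in> words k d" "p < d"
  shows "clear p (suffixes k (d - p)) x = replicate (Suc p) 0 @ drop (Suc p) x"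
proof -
  have "drop p x \<in> words k (d - p)" using assms(1) by (rule words_drop)
  then show ?thesis
    using drop_eq_nth_Cons[OF assms]
    by (auto simp: clear_def suffixes_def replicate_append_same[symmetric])
qed

text \<open>The end of one phase is the start of the next, as both maps agree on words; after the
  last position a single class is left.\<close>

lemma contractible_clear_empty:
  assumes k: "k \<ge> 2" and "p < d"
  shows "contractible (2 * (k - 1) ^ (d - 1)) (quot (weak_power d k) (clear p {}))"
  using assms(2)
proof (induction "d - p" arbitrary: p rule: less_induct)
  case less
  let ?G = "weak_power d k"
  have V: "verts ?G = words k d" using less(2) by (simp add: verts_weak_power)
  have "contractible (2 * (k - 1) ^ (d - 1)) (quot ?G (clear p (suffixes k (d - p))))"
  proof (cases "Suc p = d")
    case True
    have ne: "words k d \<noteq> {}" using card_words[of k d] k by auto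
    have "quot ?G (clear p (suffixes k (d - p))) = quot ?G (\<lambda>_. replicate d 0)"
      using clear_suffixes[of _ k d p] True less(2)
      by (intro quot_cong) (auto simp: V words_def)
    also have "\<dots> = complete_graph {replicate d 0}"
      unfolding quot_def V complete_graph_def using ne card_2_subset_singleton by fastforce
    finally show ?thesis by (simp add: single)
  next
    case False
    then have sp: "Suc p < d" using less(2) by simp
    have "quot ?G (clear p (suffixes k (d - p))) = quot ?G (clear (Suc p) {})"
      using clear_suffixes[of _ k d p] sp drop_eq_nth_Cons[of _ k d "Suc p"]
      by (intro quot_cong) (simp add: V clear_def)
    then show ?thesis using less(1)[of "Suc p"] sp by simp
  qed
  then show ?case using contractible_clear[OF less(2) k admissible_empty] by blast
qed

lemma contractible_weak_power:
  assumes k: "k \<ge> 2" and d: "d \<ge> 1"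
  shows "contractible (2 * (k - 1) ^ (d - 1)) (weak_power d k)"
proof -
  \<comment> \<open>With nothing merged at position 0, \<open>clear\<close> fixes every word, so the
    first phase starts at the graph itself.\<close>
  have "quot (weak_power d k) (clear 0 {}) = quot (weak_power d k) (\<lambda>x. x)"
    using drop_eq_nth_Cons[of _ k d 0] d
    by (intro quot_cong) (simp add: clear_def verts_weak_power)
  also have "\<dots> = weak_power d k"
    using d by (simp add: quot_ident is_trigraph_weak_power red_weak_power)
  finally show ?thesis using contractible_clear_empty[OF k, of 0 d] d by simp
qed

section \<open>At most two letters, or a single factor\<close>

text \<open>With two letters, the letter different from a given one is determined. So every word has
  at most one neighbour and the graph is a matching.\<close>

lemma differ_binary_unique:
  assumes "x \<in> words k d" "y \<in> words k d" "z \<in> words k d" "k \<le> 2" "differ x y" "differ x z"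
  shows "y = z"
proof (rule nth_equalityI)
  show "length y = length z" using assms by (simp add: words_def)
  fix i assume i: "i < length y"
  have bin: "w ! i \<in> {0, 1}" if "w \<in> words k d" for w
  proof -
    have "w ! i \<in> set w" using that i assms(2) by (simp add: words_def)
    then show ?thesis using that \<open>k \<le> 2\<close> by (auto simp: words_def)
  qed
  have "x ! i \<noteq> y ! i" "x ! i \<noteq> z ! i"
    using assms(2,3,5,6) i by (auto simp: list_all2_conv_all_nth words_def)
  then show "y ! i = z ! i" using bin[OF assms(1)] bin[OF assms(2)] bin[OF assms(3)] by auto
qed

lemma contractible_weak_power_binary:
  assumes d: "d \<ge> 1" and k: "1 \<le> k" "k \<le> 2"
  shows "contractible 0 (weak_power d k)"
proof (rule contractible_matching)
  show "is_trigraph (weak_power d k)" "red (weak_power d k) = {}"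
    using d by (simp_all add: is_trigraph_weak_power red_weak_power)
  show "verts (weak_power d k) \<noteq> {}"
    using card_words[of k d] k d by (auto simp: verts_weak_power)
  \<comment> \<open>Edges are unordered; this writes an edge with the common vertex first.\<close>
  have edge_at: "\<exists>y. E = {x, y} \<and> x \<in> words k d \<and> y \<in> words k d \<and> differ x y"
    if E: "E \<in> black (weak_power d k)" "x \<in> E" for E x
  proof -
    obtain a b where ab: "E = {a, b}" "a \<in> words k d" "b \<in> words k d" "differ a b"
      using E(1) d by (auto simp: weak_power_eq)
    then consider "x = a" | "x = b" using E(2) by blast
    then show ?thesis
    proof cases
      case 1
      then show ?thesis using ab by blast
    next
      case 2
      then have "E = {x, a}" "differ x a" using ab differ_sym by auto
      then show ?thesis using ab 2 by blast
    qed
  qed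
  fix E E' assume E: "E \<in> black (weak_power d k)" "E' \<in> black (weak_power d k)" "E \<inter> E' \<noteq> {}"
  then obtain x where x: "x \<in> E" "x \<in> E'" by blast
  obtain y where y: "E = {x, y}" "x \<in> words k d" "y \<in> words k d" "differ x y"
    using edge_at[OF E(1) x(1)] by blast
  obtain y' where y': "E' = {x, y'}" "y' \<in> words k d" "differ x y'"
    using edge_at[OF E(2) x(2)] by blast
  have "y = y'" using y(2,3) y'(2) k(2) y(4) y'(3) by (rule differ_binary_unique)
  then show "E = E'" using y(1) y'(1) by simp
qed

lemma contractible_weak_power_1:
  assumes "k \<ge> 1"
  shows "contractible 0 (weak_power 1 k)"
proof -
  have wp: "verts (weak_power 1 k) = words k 1" "red (weak_power 1 k) = {}"
    by (simp_all only: verts_weak_power red_weak_power order_refl)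
  have "weak_power 1 k = complete_graph (words k 1)"
  proof (rule trigraph_eqI)
    show "black (weak_power 1 k) \<subseteq> {e. card e = 2}"
      using is_trigraph_weak_power[of 1 k] by (auto simp: is_trigraph_def)
    fix a b :: "nat list" assume "a \<noteq> b"
    then show "{a, b} \<in> black (weak_power 1 k) \<longleftrightarrow> {a, b} \<in> black (complete_graph (words k 1))"
      unfolding black_weak_power_iff[OF order_refl]
      by (auto simp: complete_graph_def words_def length_Suc_conv)
  qed (auto simp only: wp complete_graph_def trigraph.simps)
  moreover have "words k 1 \<noteq> {}" using card_words[of k 1] assms by auto
  ultimately show ?thesis by (simp add: contractible_complete_graph finite_words)
qed

theorem proposition3p6:
  fixes d k :: nat
  assumes "d \<ge> 1" and "k \<ge> 1"
  shows "tww (weak_power d k) = (if d = 1 \<or> k \<le> 2 then 0 else 2 * (k - 1) ^ (d - 1))"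
proof (cases "d = 1 \<or> k \<le> 2")
  case True
  then have "contractible 0 (weak_power d k)"
    using assms contractible_weak_power_1 contractible_weak_power_binary by auto
  then show ?thesis using True tww_le by fastforce
next
  case False
  then have dk: "d \<ge> 2" "k \<ge> 3" using assms by auto
  then have c: "contractible (2 * (k - 1) ^ (d - 1)) (weak_power d k)"
    by (intro contractible_weak_power) auto
  have "tww (weak_power d k) = 2 * (k - 1) ^ (d - 1)"
    unfolding tww_def
  proof (rule Least_equality)
    show "\<exists>S. is_d_sequence (2 * (k - 1) ^ (d - 1)) (weak_power d k) S"
      using contractible_is_d_sequence[OF c] by blast
    show "2 * (k - 1) ^ (d - 1) \<le> D" if "\<exists>S. is_d_sequence D (weak_power d k) S" for D
      using that d_sequence_weak_power_ge dk by blast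
  qed
  then show ?thesis using False by simp
qed

end
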